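(* For the closure space $(S^1,c_r)$, where $S^1$ is the circle of circumference $1$ with its geodesic metric and $r\ge 0$ is real, \[H_1(S^1,c_r)\cong\begin{cases} \mathbb{Z}, & 0\le r<\frac{1}{3},\\ 0, & \frac{1}{2}\le r. \end{cases}\]
   Context: A (Čech) closure space is a pair $(X,c)$ of a set $X$ and a function $c:2^X\to 2^X$ with $c(\varnothing)=\varnothing$, $A\subset c(A)$, and $c(A\cup B)=c(A)\cup c(B)$ for all $A,B\subset X$. Topological spaces are the closure spaces with $c(c(A))=c(A)$ for all $A$, where $c$ is the topological closure. A map $f:(X,c)\to(Y,d)$ is continuous if $f(c(A))\subset d(f(A))$ for all $A\subset X$. $S^1$ is the circle with geodesic metric $d$ and circumference $1$ (i.e. $\mathbb{R}/\mathbb{Z}$ with its quotient metric). For $A\subset S^1$ nonempty, $c_r(A)=\{x\in S^1 : \inf_{y\in A}d(x,y)\le r\}$, and $c_r(\varnothing)=\varnothing$. Singular homology: let $|\Delta^n|=\{(t_0,\dots,t_n)\in\mathbb{R}^{n+1} : \sum_i t_i=1,\ t_i\ge 0\}=[e_0,\dots,e_n]$ with the Euclidean topology. For a closure space $X$, $C_n(X)$ is the free abelian group on continuous maps $\sigma:|\Delta^n|\to X$ (and $C_n(X)=0$ for $n<0$), $\partial_n(\sigma)=\sum_{i=0}^n(-1)^i\sigma|_{[e_0,\dots,\hat e_i,\dots,e_n]}$, and $H_n(X)=\ker\partial_n/\operatorname{im}\partial_{n+1}$; $H_n(X,c)$ here denotes $H_n$ of the closure space $(X,c)$ (not relative homology).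 *)

theory Defs
  imports "HOL-Analysis.Analysis" "HOL-Homology.Homology"
begin

section \<open>Closure spaces\<close>

text \<open>A closure space is given by its carrier \<open>X\<close> and its closure operator \<open>c\<close>; the values of \<open>c\<close>
  on sets that are not subsets of \<open>X\<close> are irrelevant.\<close>

definition closure_space :: "'a set \<Rightarrow> ('a set \<Rightarrow> 'a set) \<Rightarrow> bool" where
  "closure_space X c \<longleftrightarrow>
     c {} = {} \<and>
     (\<forall>A. A \<subseteq> X \<longrightarrow> A \<subseteq> c A \<and> c A \<subseteq> X) \<and>
     (\<forall>A B. A \<subseteq> X \<longrightarrow> B \<subseteq> X \<longrightarrow> c (A \<union> B) = c A \<union> c B)"

definition closure_continuous ::
  "'a set \<Rightarrow> ('a set \<Rightarrow> 'a set) \<Rightarrow> 'b set \<Rightarrow> ('b set \<Rightarrow> 'b set) \<Rightarrow> ('a \<Rightarrow> 'b) \<Rightarrow> bool" where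
  "closure_continuous X c Y d f \<longleftrightarrow>
     f ` X \<subseteq> Y \<and> (\<forall>A. A \<subseteq> X \<longrightarrow> f ` (c A) \<subseteq> d (f ` A))"

lemma closure_space_topology: "closure_space (topspace T) ((closure_of) T)"
  by (auto simp: closure_space_def closure_of_Un closure_of_subset in_closure_of)

section \<open>Singular homology of closure spaces\<close>

text \<open>The simplex \<^const>\<open>standard_simplex\<close> lives in the space of sequences and is supported on the
  coordinates \<open>0, \<dots>, n\<close>, so the subspace topology of the product topology is the Euclidean one.
  As for singular simplices of topological spaces in the library, maps are normalised to be
  \<^const>\<open>undefined\<close> outside the simplex, so that each map on the simplex has one representative.\<close>

abbreviation simplex_space :: "nat \<Rightarrow> (nat \<Rightarrow> real) topology" where
  "simplex_space n \<equiv> subtopology (powertop_real UNIV) (standard_simplex n)"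

definition closure_simplex ::
  "nat \<Rightarrow> 'a set \<Rightarrow> ('a set \<Rightarrow> 'a set) \<Rightarrow> ((nat \<Rightarrow> real) \<Rightarrow> 'a) \<Rightarrow> bool" where
  "closure_simplex n X c \<sigma> \<longleftrightarrow>
     closure_continuous (standard_simplex n) ((closure_of) (simplex_space n)) X c \<sigma> \<and>
     \<sigma> \<in> extensional (standard_simplex n)"

definition closure_chain_group ::
  "nat \<Rightarrow> 'a set \<Rightarrow> ('a set \<Rightarrow> 'a set) \<Rightarrow> 'a chain monoid" where
  "closure_chain_group n X c = free_Abelian_group {\<sigma>. closure_simplex n X c \<sigma>}"

text \<open>The library's \<^const>\<open>chain_boundary\<close> is the alternating sum of the faces and does not refer to a
  topology. In degree \<open>0\<close> it is the zero map, so that the kernel below is the whole chain group.\<close>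

definition closure_cycles ::
  "nat \<Rightarrow> 'a set \<Rightarrow> ('a set \<Rightarrow> 'a set) \<Rightarrow> 'a chain set" where
  "closure_cycles n X c =
     kernel (closure_chain_group n X c) (closure_chain_group (n - 1) X c) (chain_boundary n)"

definition closure_boundaries ::
  "nat \<Rightarrow> 'a set \<Rightarrow> ('a set \<Rightarrow> 'a set) \<Rightarrow> 'a chain set" where
  "closure_boundaries n X c =
     chain_boundary (Suc n) ` carrier (closure_chain_group (Suc n) X c)"

definition closure_homology_group ::
  "nat \<Rightarrow> 'a set \<Rightarrow> ('a set \<Rightarrow> 'a set) \<Rightarrow> 'a chain set monoid" where
  "closure_homology_group n X c =
     subgroup_generated (closure_chain_group n X c) (closure_cycles n X c)
       Mod closure_boundaries n X c"

text \<open>The quotient is well formed: faces of simplices are simplices and boundaries are cycles.\<close>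

lemma closure_simplex_singular_face:
  assumes f: "closure_simplex p X c f" and p: "1 \<le> p" "k \<le> p"
  shows "closure_simplex (p - 1) X c (singular_face p k f)"
proof -
  let ?PT = "powertop_real UNIV"
  let ?S = "standard_simplex (p - 1)"
  let ?g = "singular_face p k f"
  have 0: "simplical_face k \<in> ?S \<rightarrow> standard_simplex p"
    using p simplical_face_in_standard_simplex by auto
  have cont: "continuous_map (simplex_space (p - 1)) (simplex_space p) (simplical_face k)"
  proof (clarsimp simp add: continuous_map_in_subtopology simplical_face_in_standard_simplex
      continuous_map_componentwise 0[simplified])
    fix i
    have "continuous_map ?PT euclideanreal
        (\<lambda>x. if i < k then x i else if i = k then 0 else x (i - 1))"
      by (auto intro: continuous_map_product_projection)
    then show "continuous_map (simplex_space (p - Suc 0)) euclideanreal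
        (\<lambda>x. simplical_face k x i)"
      by (simp add: simplical_face_def continuous_map_from_subtopology)
  qed
  have g: "?g x = f (simplical_face k x)" if "x \<in> ?S" for x
    using that by (simp add: singular_face_def)
  have clo: "?g ` (simplex_space (p - 1) closure_of A) \<subseteq> c (?g ` A)" if A: "A \<subseteq> ?S" for A
  proof -
    have "simplex_space (p - 1) closure_of A \<subseteq> ?S"
      by (metis closure_of_subset_topspace topspace_standard_simplex)
    then have "?g ` (simplex_space (p - 1) closure_of A)
        = f ` simplical_face k ` (simplex_space (p - 1) closure_of A)"
      unfolding image_image using g by (intro image_cong) auto
    also have "\<dots> \<subseteq> f ` (simplex_space p closure_of (simplical_face k ` A))"
      by (intro image_mono continuous_map_image_closure_subset cont)
    also have "\<dots> \<subseteq> c (f ` simplical_face k ` A)"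
    proof -
      have "simplical_face k ` A \<subseteq> standard_simplex p"
        using 0 A by auto
      then show ?thesis
        using f unfolding closure_simplex_def closure_continuous_def by blast
    qed
    also have "f ` simplical_face k ` A = ?g ` A"
      unfolding image_image using g A by (intro image_cong) auto
    finally show ?thesis .
  qed
  have "f ` standard_simplex p \<subseteq> X"
    using f by (simp add: closure_simplex_def closure_continuous_def)
  then have "?g ` ?S \<subseteq> X"
    using 0 g by fastforce
  moreover have "?g \<in> extensional ?S"
    by (simp add: singular_face_def)
  ultimately show ?thesis
    using clo unfolding closure_simplex_def closure_continuous_def by blast
qed

lemma hom_chain_boundary:
  "group_hom (closure_chain_group n X c) (closure_chain_group (n - 1) X c) (chain_boundary n)"
proof -
  have *: "chain_boundary n x \<in> carrier (closure_chain_group (n - 1) X c)"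
    if x: "x \<in> carrier (closure_chain_group n X c)" for x
  proof (cases "n = 0")
    case True
    then show ?thesis
      by (simp add: chain_boundary_def closure_chain_group_def free_Abelian_group_def)
  next
    case False
    let ?F = "\<lambda>f. \<Sum>k\<le>n. frag_cmul ((-1) ^ k) (frag_of (singular_face n k f))"
    have keys: "Poly_Mapping.keys (?F f) \<subseteq> {\<sigma>. closure_simplex (n - 1) X c \<sigma>}"
      if "closure_simplex n X c f" for f
    proof -
      have "Poly_Mapping.keys (?F f)
          \<subseteq> (\<Union>k\<le>n. Poly_Mapping.keys (frag_cmul ((-1) ^ k) (frag_of (singular_face n k f))))"
        by (rule keys_sum)
      also have "\<dots> \<subseteq> (\<Union>k\<le>n. {singular_face n k f})"
        by (intro UN_mono order_refl order_trans[OF keys_cmul]) auto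
      also have "\<dots> \<subseteq> {\<sigma>. closure_simplex (n - 1) X c \<sigma>}"
        using False closure_simplex_singular_face[OF that] by auto
      finally show ?thesis .
    qed
    have "Poly_Mapping.keys (frag_extend ?F x)
        \<subseteq> (\<Union>f\<in>Poly_Mapping.keys x. Poly_Mapping.keys (?F f))"
      by (rule keys_frag_extend)
    also have "\<dots> \<subseteq> {\<sigma>. closure_simplex (n - 1) X c \<sigma>}"
      using x keys by (auto simp: closure_chain_group_def free_Abelian_group_def)
    finally show ?thesis
      using False by (simp add: chain_boundary_def closure_chain_group_def free_Abelian_group_def)
  qed
  then show ?thesis
    by (auto simp: group_hom_def group_hom_axioms_def hom_def closure_chain_group_def
        chain_boundary_add)
qed

lemma closure_boundaries_subset_cycles: "closure_boundaries n X c \<subseteq> closure_cycles n X c"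
proof -
  interpret group_hom "closure_chain_group (Suc n) X c" "closure_chain_group n X c"
    "chain_boundary (Suc n)"
    using hom_chain_boundary[of "Suc n"] by simp
  have "chain_boundary n (chain_boundary (Suc n) d) = 0"
    if "d \<in> carrier (closure_chain_group (Suc n) X c)" for d
  proof -
    have top: "continuous_map (simplex_space (Suc n)) (topology_generated_by {UNIV}) f" for f
      by (rule continuous_on_generated_topo)
        (auto simp: topspace_standard_simplex intro: openin_topspace[of "simplex_space (Suc n)",
          unfolded topspace_standard_simplex])
    have "singular_chain (Suc n) (topology_generated_by {UNIV}) d"
      using that unfolding singular_chain_def singular_simplex_def closure_chain_group_def
        free_Abelian_group_def closure_simplex_def by (auto intro: top)
    then show ?thesis
      using chain_boundary_boundary by fastforce
  qed
  then show ?thesis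
    by (auto simp: closure_boundaries_def closure_cycles_def kernel_def)
      (simp add: closure_chain_group_def)
qed

lemma comm_group_closure_homology_group: "comm_group (closure_homology_group n X c)"
proof -
  interpret C: comm_group "closure_chain_group n X c"
    by (simp add: closure_chain_group_def abelian_free_Abelian_group)
  interpret Z: comm_group "subgroup_generated (closure_chain_group n X c) (closure_cycles n X c)"
    by (rule C.abelian_subgroup_generated) (rule C.comm_group_axioms)
  interpret B: group_hom "closure_chain_group (Suc n) X c" "closure_chain_group n X c"
    "chain_boundary (Suc n)"
    using hom_chain_boundary[of "Suc n"] by simp
  show ?thesis
    unfolding closure_homology_group_def
    by (intro Z.abelian_FactGroup C.subgroup_of_subgroup_generated
        closure_boundaries_subset_cycles)
      (simp add: closure_boundaries_def B.img_is_subgroup)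
qed

lemma carrier_closure_cycle_group:
  "carrier (subgroup_generated (closure_chain_group n X c) (closure_cycles n X c))
     = closure_cycles n X c"
proof -
  interpret group_hom "closure_chain_group n X c" "closure_chain_group (n - 1) X c"
    "chain_boundary n"
    by (rule hom_chain_boundary)
  show ?thesis
    unfolding closure_cycles_def
    by (rule subgroup.carrier_subgroup_generated_subgroup[OF subgroup_kernel])
qed

section \<open>The circle of circumference 1\<close>

text \<open>The points of the circle are the cosets of the integers in the reals. The quotient metric is
  the infimum of the distances between representatives, which is what \<^const>\<open>setdist\<close> computes for
  nonempty sets.\<close>

definition circle :: "real set set" where
  "circle = UNIV // {(x, y). x - y \<in> \<int>}"

definition circle_dist :: "real set \<Rightarrow> real set \<Rightarrow> real" where
  "circle_dist P Q = setdist P Q"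

definition circle_closure :: "real \<Rightarrow> real set set \<Rightarrow> real set set" where
  "circle_closure r A =
     (if A = {} then {} else {P \<in> circle. (INF Q\<in>A. circle_dist P Q) \<le> r})"

lemma closure_space_circle:
  assumes "0 \<le> r"
  shows "closure_space circle (circle_closure r)"
proof -
  have bdd: "bdd_below (circle_dist P ` A)" for P A
    by (rule bdd_belowI[of _ 0]) (auto simp: circle_dist_def setdist_pos_le)
  have sub: "A \<subseteq> circle_closure r A" if "A \<subseteq> circle" for A
  proof
    fix P assume P: "P \<in> A"
    have "(INF Q\<in>A. circle_dist P Q) \<le> circle_dist P P"
      using P bdd by (rule cINF_lower[rotated])
    also have "\<dots> = 0"
      by (simp add: circle_dist_def setdist_refl)
    finally show "P \<in> circle_closure r A"
      using P that assms by (auto simp: circle_closure_def)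
  qed
  have un: "circle_closure r (A \<union> B) = circle_closure r A \<union> circle_closure r B" for A B
  proof (cases "A = {} \<or> B = {}")
    case True
    then show ?thesis by (auto simp: circle_closure_def)
  next
    case False
    then have "(INF Q\<in>A \<union> B. circle_dist P Q)
        = min (INF Q\<in>A. circle_dist P Q) (INF Q\<in>B. circle_dist P Q)" for P
      by (subst cINF_union) (auto simp: bdd inf_min)
    with False show ?thesis
      by (auto simp: circle_closure_def min_le_iff_disj)
  qed
  show ?thesis
    unfolding closure_space_def using sub un by (auto simp: circle_closure_def split: if_splits)
qed

end

theory Submission
  imports Defs
begin

text \<open>
  A simplex \<open>\<sigma>\<close> of \<open>circle_closure r\<close> is a function that may be discontinuous, but whose jumps,
  measured from the value at each point to the values nearby, are at most \<open>r\<close>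
  (\<open>closure_simplex_circle_iff\<close>). For \<open>r < 1 / 3\<close> such functions behave like continuous ones with
  respect to the covering of the circle by the real line: every simplex of dimension \<open>1\<close> or \<open>2\<close> lifts
  to a real function with jumps at most \<open>r\<close> (\<open>closure_simplex_lift\<close>), and the lift is unique up to an
  integer (\<open>lifts_unique\<close>). The point is that three points of the circle at pairwise distance less
  than \<open>1 / 3\<close> cannot surround it (\<open>lifts_local\<close>).

  The real line with such jumps is still contractible, by the cone on \<open>0\<close> (\<open>jumps_le_cone\<close>). So a path
  with a lift from \<open>a\<close> to \<open>b\<close> is homologous to \<open>arc_chain b - arc_chain a\<close>, where \<open>arc_chain b\<close> is the
  path under the segment from \<open>0\<close> to \<open>b\<close>. Applied to translates of segments, this shows that
  \<open>arc_chain b\<close> is homologous to \<open>arc_chain (frac b)\<close> plus \<open>\<lfloor>b\<rfloor>\<close> times the standard loop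
  \<open>arc_chain 1\<close> (\<open>arc_chain_frac\<close>). The first summand depends only on the end point of the path, and
  such terms cancel in a cycle (\<open>homologous_cycle\<close>). A cycle is thus homologous to a multiple of the
  standard loop, the factor being its winding number. The winding number vanishes on boundaries
  because \<open>2\<close>-simplices lift, so it induces an isomorphism to the integers.

  For \<open>1 / 2 \<le> r\<close> every function into the circle is a simplex, and any choice of real
  representatives serves as a lift of a path. Choosing them in \<open>[0, 1)\<close>, the same argument gives
  winding number \<open>0\<close> to every path, so every cycle is a boundary.
\<close>

section \<open>Functions with bounded jumps\<close>

text \<open>
  The limit superior of \<open>d (f x) (f y)\<close>, as \<open>y\<close> tends to \<open>x\<close> in \<open>S\<close>, is at most \<open>r\<close>. The bound is
  centred at \<open>x\<close>: two points arbitrarily near \<open>x\<close> may have values at distance \<open>2 * r\<close>.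
\<close>

definition jumps_le ::
  "('b \<Rightarrow> 'b \<Rightarrow> real) \<Rightarrow> real \<Rightarrow> 'a::topological_space set \<Rightarrow> ('a \<Rightarrow> 'b) \<Rightarrow> bool" where
  "jumps_le d r S f \<longleftrightarrow>
     (\<forall>x\<in>S. \<forall>e>r. \<exists>U. open U \<and> x \<in> U \<and> (\<forall>y\<in>S \<inter> U. d (f x) (f y) < e))"

lemma jumps_leE:
  assumes "jumps_le d r S f" "x \<in> S" "r < e"
  obtains U where "open U" "x \<in> U" "\<And>y. y \<in> S \<Longrightarrow> y \<in> U \<Longrightarrow> d (f x) (f y) < e"
proof -
  have "\<exists>U. open U \<and> x \<in> U \<and> (\<forall>y\<in>S \<inter> U. d (f x) (f y) < e)"
    using assms by (simp add: jumps_le_def)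
  with that show thesis
    by (metis IntI)
qed

lemma jumps_le_cong:
  assumes "jumps_le d r S f" "\<And>x. x \<in> S \<Longrightarrow> f x = g x"
  shows "jumps_le d r S g"
  using assms unfolding jumps_le_def by simp

lemma jumps_le_subset:
  assumes "jumps_le d r T f" "S \<subseteq> T"
  shows "jumps_le d r S f"
  unfolding jumps_le_def
proof (intro ballI allI impI)
  fix x e assume "x \<in> S" "r < e"
  then obtain U where "open U" "x \<in> U" "\<And>y. y \<in> T \<Longrightarrow> y \<in> U \<Longrightarrow> d (f x) (f y) < e"
    using jumps_leE[OF assms(1), of x e] assms(2) by auto
  then show "\<exists>U. open U \<and> x \<in> U \<and> (\<forall>y\<in>S \<inter> U. d (f x) (f y) < e)"
    using assms(2) by (intro exI[of _ U]) auto
qed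

lemma jumps_le_compose:
  assumes f: "jumps_le d r T f" and h: "continuous_on S h" "h ` S \<subseteq> T"
  shows "jumps_le d r S (f \<circ> h)"
  unfolding jumps_le_def
proof (intro ballI allI impI)
  fix x e assume x: "x \<in> S" and e: "r < e"
  obtain U where U: "open U" "h x \<in> U" "\<And>y. y \<in> T \<Longrightarrow> y \<in> U \<Longrightarrow> d (f (h x)) (f y) < e"
    using jumps_leE[OF f _ e, of "h x"] x h(2) by (metis image_subset_iff)
  obtain V where V: "open V" "V \<inter> S = h -` U \<inter> S"
    using h(1) U(1) unfolding continuous_on_open_invariant by blast
  have "x \<in> V"
    using V(2) U(2) x by auto
  moreover have "d ((f \<circ> h) x) ((f \<circ> h) y) < e" if "y \<in> S \<inter> V" for y
    using U(3)[of "h y"] V(2) that h(2) by auto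
  ultimately show "\<exists>U. open U \<and> x \<in> U \<and> (\<forall>y\<in>S \<inter> U. d ((f \<circ> h) x) ((f \<circ> h) y) < e)"
    using V(1) by (intro exI[of _ V]) simp
qed

lemma jumps_le_continuous:
  fixes g :: "'a::topological_space \<Rightarrow> real"
  assumes "0 \<le> r" "continuous_on UNIV g"
  shows "jumps_le dist r S g"
  unfolding jumps_le_def
proof (intro ballI allI impI)
  fix x e assume e: "r < e"
  let ?U = "{y. dist (g x) (g y) < e}"
  have "open ?U"
    by (intro open_Collect_less continuous_intros assms(2))
  then show "\<exists>U. open U \<and> x \<in> U \<and> (\<forall>y\<in>S \<inter> U. dist (g x) (g y) < e)"
    using assms(1) e by (intro exI[of _ ?U]) auto
qed

text \<open>
  A point outside one of the closed sets has a neighbourhood that misses it; a point of both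
  sees its own value from both sides.
\<close>

lemma jumps_le_Un_closed:
  assumes A: "closed A" "jumps_le d r A g" and B: "closed B" "jumps_le d r B g"
  shows "jumps_le d r (A \<union> B) g"
  unfolding jumps_le_def
proof (intro ballI allI impI)
  fix x e assume x: "x \<in> A \<union> B" and e: "r < e"
  have *: "\<exists>U. open U \<and> x \<in> U \<and> (\<forall>y\<in>C \<inter> U. d (g x) (g y) < e)"
    if "closed C" "jumps_le d r C g" for C
  proof (cases "x \<in> C")
    case True
    then show ?thesis
      using that(2) e by (simp add: jumps_le_def)
  next
    case False
    then show ?thesis
      using that(1) by (intro exI[of _ "- C"]) auto
  qed
  obtain U where "open U" "x \<in> U" "\<forall>y\<in>A \<inter> U. d (g x) (g y) < e"
    using *[OF A] by (elim exE conjE)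
  moreover obtain V where "open V" "x \<in> V" "\<forall>y\<in>B \<inter> V. d (g x) (g y) < e"
    using *[OF B] by (elim exE conjE)
  ultimately show "\<exists>U. open U \<and> x \<in> U \<and> (\<forall>y\<in>(A \<union> B) \<inter> U. d (g x) (g y) < e)"
    by (intro exI[of _ "U \<inter> V"]) auto
qed

lemma jumps_le_bounded:
  fixes g :: "'a::topological_space \<Rightarrow> real"
  assumes r: "0 \<le> r" and S: "compact S" and g: "jumps_le dist r S g"
  obtains M where "0 \<le> M" "\<And>x. x \<in> S \<Longrightarrow> \<bar>g x\<bar> \<le> M"
proof -
  have "\<forall>x\<in>S. \<exists>U. open U \<and> x \<in> U \<and> (\<forall>y\<in>S \<inter> U. dist (g x) (g y) < r + 1)"
    using g by (simp add: jumps_le_def)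
  from bchoice[OF this] obtain U
    where U: "\<forall>x\<in>S. open (U x) \<and> x \<in> U x \<and> (\<forall>y\<in>S \<inter> U x. dist (g x) (g y) < r + 1)"
    by (elim exE)
  obtain C where C: "C \<subseteq> S" "finite C" "S \<subseteq> (\<Union>x\<in>C. U x)"
    using U by (rule_tac compactE_image[OF S, of S U]) auto
  define M where "M = (\<Sum>x\<in>C. \<bar>g x\<bar> + r + 1)"
  show thesis
  proof
    show "0 \<le> M"
      unfolding M_def using r by (intro sum_nonneg) auto
    fix y assume y: "y \<in> S"
    then obtain x where x: "x \<in> C" "y \<in> U x"
      using C(3) by auto
    then have "dist (g x) (g y) < r + 1"
      using U C(1) y by auto
    then have "\<bar>g y\<bar> \<le> \<bar>g x\<bar> + r + 1"
      unfolding dist_real_def by linarith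
    also have "\<dots> \<le> M"
      unfolding M_def by (rule member_le_sum) (use C x r in auto)
    finally show "\<bar>g y\<bar> \<le> M" .
  qed
qed

section \<open>The real line over the circle\<close>

definition circle_pt :: "real \<Rightarrow> real set" where
  "circle_pt t = {s. s - t \<in> \<int>}"

lemma circle_eq_range: "circle = range circle_pt"
proof -
  have "{(x, y). x - y \<in> \<int>} `` {t} = circle_pt t" for t :: real
    unfolding circle_pt_def using minus_in_Ints_iff[of "t - _"] by auto
  then show ?thesis
    unfolding circle_def quotient_def by auto
qed

lemma circle_pt_in_circle [simp]: "circle_pt t \<in> circle"
  by (simp add: circle_eq_range)

lemma circle_pt_eq_iff: "circle_pt s = circle_pt t \<longleftrightarrow> s - t \<in> \<int>"
proof
  assume "circle_pt s = circle_pt t"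
  moreover have "s \<in> circle_pt s"
    by (simp add: circle_pt_def)
  ultimately show "s - t \<in> \<int>"
    by (simp add: circle_pt_def)
next
  assume st: "s - t \<in> \<int>"
  have "u - s \<in> \<int> \<longleftrightarrow> u - t \<in> \<int>" for u
    using Ints_add[OF _ st, of "u - s"] Ints_diff[OF _ st, of "u - t"] by auto
  then show "circle_pt s = circle_pt t"
    by (simp add: circle_pt_def)
qed

lemma circle_pt_eqE:
  assumes "circle_pt s = circle_pt t"
  obtains k :: int where "s = t + of_int k"
  using assms unfolding circle_pt_eq_iff by (metis Ints_cases add.commute diff_add_cancel)

lemma circle_pt_add_int [simp]: "circle_pt (t + of_int k) = circle_pt t"
  by (simp add: circle_pt_eq_iff)

lemma circle_dist_le: "circle_dist (circle_pt s) (circle_pt t) \<le> dist s t"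
  unfolding circle_dist_def by (rule setdist_le_dist) (auto simp: circle_pt_def)

lemma circle_dist_less_imp_lift:
  assumes "circle_dist (circle_pt s) P < e" "P \<in> circle"
  obtains t where "circle_pt t = P" "dist s t < e"
proof -
  obtain u where u: "P = circle_pt u"
    using assms(2) unfolding circle_eq_range by auto
  have "circle_pt s \<noteq> {}" "P \<noteq> {}"
    unfolding u circle_pt_def by (auto intro: exI[of _ s] exI[of _ u])
  then obtain x y where xy: "x \<in> circle_pt s" "y \<in> P" "dist x y < e"
    using assms(1) unfolding circle_dist_def by (metis setdist_ltE)
  obtain m n where mn: "x = s + of_int m" "y = u + of_int n"
    using xy u circle_pt_eqE[of x s] circle_pt_eqE[of y u] circle_pt_eq_iff
    by (metis circle_pt_def mem_Collect_eq)
  show thesis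
  proof
    show "circle_pt (u + of_int (n - m)) = P"
      using u circle_pt_add_int by blast
    show "dist s (u + of_int (n - m)) < e"
      using xy(3) unfolding mn dist_real_def by (simp add: algebra_simps)
  qed
qed

lemma circle_dist_le_half:
  assumes "P \<in> circle" "Q \<in> circle"
  shows "circle_dist P Q \<le> 1 / 2"
proof -
  obtain s t where st: "P = circle_pt s" "Q = circle_pt t"
    using assms unfolding circle_eq_range by auto
  have "circle_dist P Q \<le> dist s (t + of_int (round (s - t)))"
    unfolding st by (metis circle_dist_le circle_pt_add_int)
  also have "\<dots> \<le> 1 / 2"
    using of_int_round_abs_le[of "s - t"] by (simp add: dist_real_def abs_minus_commute algebra_simps)
  finally show ?thesis .
qed

text \<open>
  A real lift \<open>u\<close> of the second point with \<open>\<bar>s - u\<bar> < e\<close> differs from \<open>t\<close> by an integer of absolute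
  value less than \<open>1\<close>.
\<close>

lemma circle_dist_less_imp_dist_less:
  assumes "circle_dist (circle_pt s) (circle_pt t) < e" "dist s t + e \<le> 1"
  shows "dist s t < e"
proof -
  obtain u where u: "circle_pt u = circle_pt t" "dist s u < e"
    using circle_dist_less_imp_lift[OF assms(1)] by auto
  obtain k :: int where k: "u = t + of_int k"
    using u(1) by (rule circle_pt_eqE)
  have "\<bar>real_of_int k\<bar> < 1"
    using u(2) assms(2) unfolding k dist_real_def by linarith
  then have "k = 0"
    by linarith
  with u k show ?thesis
    by simp
qed

lemma in_closure_of_simplex_space:
  assumes "A \<subseteq> standard_simplex n"
  shows "x \<in> simplex_space n closure_of A \<longleftrightarrow>
    x \<in> standard_simplex n \<and> (\<forall>U. open U \<longrightarrow> x \<in> U \<longrightarrow> A \<inter> U \<noteq> {})"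
proof -
  have "x \<in> closure A \<longleftrightarrow> (\<forall>U. open U \<longrightarrow> x \<in> U \<longrightarrow> A \<inter> U \<noteq> {})"
  proof
    show "\<forall>U. open U \<longrightarrow> x \<in> U \<longrightarrow> A \<inter> U \<noteq> {}" if "x \<in> closure A"
      using that open_Int_closure_eq_empty by (metis disjoint_iff inf_commute)
    show "x \<in> closure A" if "\<forall>U. open U \<longrightarrow> x \<in> U \<longrightarrow> A \<inter> U \<noteq> {}"
    proof (rule ccontr)
      assume "x \<notin> closure A"
      then have "A \<inter> - closure A \<noteq> {}"
        using that[rule_format, of "- closure A"] by (simp add: open_Compl)
      then show False
        using closure_subset by auto
    qed
  qed
  then show ?thesis
    using assms by (simp add: euclidean_product_topology closure_of_subtopology Int_absorb1)
qed

text \<open>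
  Continuity into \<open>circle_closure r\<close> can only fail at \<open>x\<close> through the set of those \<open>y\<close> whose value
  is at distance at least \<open>e > r\<close> from that of \<open>x\<close>, and it does fail when \<open>x\<close> is in the closure of
  this set.
\<close>

lemma closure_simplex_circle_iff:
  "closure_simplex n circle (circle_closure r) \<sigma> \<longleftrightarrow>
     \<sigma> ` standard_simplex n \<subseteq> circle \<and> jumps_le circle_dist r (standard_simplex n) \<sigma> \<and>
     \<sigma> \<in> extensional (standard_simplex n)"
proof -
  let ?S = "standard_simplex n"
  note clo = in_closure_of_simplex_space
  have bdd: "bdd_below (circle_dist P ` A)" for P A
    by (rule bdd_belowI[of _ 0]) (auto simp: circle_dist_def setdist_pos_le)
  have "(\<forall>A\<subseteq>?S. \<sigma> ` (simplex_space n closure_of A) \<subseteq> circle_closure r (\<sigma> ` A))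
      \<longleftrightarrow> jumps_le circle_dist r ?S \<sigma>" if im: "\<sigma> ` ?S \<subseteq> circle"
  proof
    assume L: "\<forall>A\<subseteq>?S. \<sigma> ` (simplex_space n closure_of A) \<subseteq> circle_closure r (\<sigma> ` A)"
    show "jumps_le circle_dist r ?S \<sigma>"
      unfolding jumps_le_def
    proof (intro ballI allI impI, rule ccontr)
      fix x e assume x: "x \<in> ?S" and e: "r < e"
        and neg: "\<nexists>U. open U \<and> x \<in> U \<and> (\<forall>y\<in>?S \<inter> U. circle_dist (\<sigma> x) (\<sigma> y) < e)"
      define A where "A = {y\<in>?S. e \<le> circle_dist (\<sigma> x) (\<sigma> y)}"
      have A: "A \<subseteq> ?S"
        by (auto simp: A_def)
      have "x \<in> simplex_space n closure_of A"
        unfolding clo[OF A]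
      proof (intro conjI x allI impI)
        fix U assume "open U" "x \<in> U"
        then obtain y where "y \<in> ?S \<inter> U" "\<not> circle_dist (\<sigma> x) (\<sigma> y) < e"
          using neg by metis
        then have "y \<in> A \<inter> U"
          by (simp add: A_def)
        then show "A \<inter> U \<noteq> {}"
          by blast
      qed
      then have "\<sigma> x \<in> circle_closure r (\<sigma> ` A)"
        using L A by blast
      then have "A \<noteq> {}" "(INF Q\<in>\<sigma> ` A. circle_dist (\<sigma> x) Q) \<le> r"
        by (auto simp: circle_closure_def split: if_splits)
      moreover have "e \<le> (INF Q\<in>\<sigma> ` A. circle_dist (\<sigma> x) Q)"
        using \<open>A \<noteq> {}\<close> by (intro cINF_greatest) (auto simp: A_def)
      ultimately show False
        using e by linarith
    qed
  next
    assume R: "jumps_le circle_dist r ?S \<sigma>"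
    show "\<forall>A\<subseteq>?S. \<sigma> ` (simplex_space n closure_of A) \<subseteq> circle_closure r (\<sigma> ` A)"
    proof (intro allI impI subsetI)
      fix A P assume A: "A \<subseteq> ?S" and "P \<in> \<sigma> ` (simplex_space n closure_of A)"
      then obtain x where x: "P = \<sigma> x" "x \<in> simplex_space n closure_of A"
        by blast
      have x': "x \<in> ?S" "\<And>U. open U \<Longrightarrow> x \<in> U \<Longrightarrow> A \<inter> U \<noteq> {}"
        using x(2) unfolding clo[OF A] by auto
      have "(INF Q\<in>\<sigma> ` A. circle_dist P Q) \<le> e" if e: "r < e" for e
      proof -
        obtain U where U: "open U" "x \<in> U" "\<And>y. y \<in> ?S \<Longrightarrow> y \<in> U \<Longrightarrow> circle_dist (\<sigma> x) (\<sigma> y) < e"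
          using jumps_leE[OF R _ e, of x] x'(1) by metis
        then obtain y where y: "y \<in> A" "y \<in> U"
          using x'(2) by blast
        have "(INF Q\<in>\<sigma> ` A. circle_dist P Q) \<le> circle_dist P (\<sigma> y)"
          using y by (intro cINF_lower bdd) auto
        also have "circle_dist P (\<sigma> y) < e"
          unfolding x(1) using U(3) y A by blast
        finally show ?thesis
          by simp
      qed
      then have "(INF Q\<in>\<sigma> ` A. circle_dist P Q) \<le> r"
        by (rule dense_ge)
      moreover have "A \<noteq> {}" "P \<in> circle"
        using x'(2)[of UNIV] x'(1) im x(1) by auto
      ultimately show "P \<in> circle_closure r (\<sigma> ` A)"
        by (simp add: circle_closure_def)
    qed
  qed
  then show ?thesis
    unfolding closure_simplex_def closure_continuous_def by blast
qed

lemma jumps_le_circle_pt: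
  assumes "jumps_le dist r S g"
  shows "jumps_le circle_dist r S (circle_pt \<circ> g)"
  unfolding jumps_le_def
proof (intro ballI allI impI)
  fix x e assume "x \<in> S" "r < e"
  then obtain U where U: "open U" "x \<in> U" "\<And>y. y \<in> S \<Longrightarrow> y \<in> U \<Longrightarrow> dist (g x) (g y) < e"
    using jumps_leE[OF assms] by metis
  have "circle_dist ((circle_pt \<circ> g) x) ((circle_pt \<circ> g) y) < e" if "y \<in> S \<inter> U" for y
    using U(3)[of y] circle_dist_le[of "g x" "g y"] that by simp
  with U show "\<exists>U. open U \<and> x \<in> U \<and>
      (\<forall>y\<in>S \<inter> U. circle_dist ((circle_pt \<circ> g) x) ((circle_pt \<circ> g) y) < e)"
    by (intro exI[of _ U]) simp
qed

section \<open>Lifting\<close>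

text \<open>
  A lift may jump, but by no more than the function that it lifts is allowed to.
\<close>

definition lifts :: "real \<Rightarrow> 'a::topological_space set \<Rightarrow> ('a \<Rightarrow> real set) \<Rightarrow> ('a \<Rightarrow> real) \<Rightarrow> bool" where
  "lifts r S f g \<longleftrightarrow> (\<forall>x\<in>S. circle_pt (g x) = f x) \<and> jumps_le dist r S g"

lemma lifts_circle_pt: "lifts r S f g \<Longrightarrow> x \<in> S \<Longrightarrow> circle_pt (g x) = f x"
  and lifts_jumps_le: "lifts r S f g \<Longrightarrow> jumps_le dist r S g"
  by (simp_all add: lifts_def)

lemma lifts_diff_int:
  assumes "lifts r S f g" "lifts r S f h" "x \<in> S"
  obtains k :: int where "g x = h x + of_int k"
  using assms circle_pt_eqE lifts_circle_pt by metis

lemma lifts_subset: "lifts r T f g \<Longrightarrow> S \<subseteq> T \<Longrightarrow> lifts r S f g"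
  unfolding lifts_def using jumps_le_subset by blast

lemma lifts_compose:
  assumes "lifts r T f g" "continuous_on S h" "h ` S \<subseteq> T"
  shows "lifts r S (f \<circ> h) (g \<circ> h)"
  using assms jumps_le_compose[OF lifts_jumps_le[OF assms(1)] assms(2,3)]
  unfolding lifts_def by auto

text \<open>
  The difference of two lifts is integer-valued, and near each point it varies by less than
  \<open>2 / 3\<close>; so it is locally constant.
\<close>

lemma lifts_unique:
  assumes r: "r < 1 / 3" and S: "connected S" and g: "lifts r S f g" and h: "lifts r S f h"
  obtains k :: int where "\<And>x. x \<in> S \<Longrightarrow> g x = h x + of_int k"
proof -
  have ev: "eventually (\<lambda>y. g x - h x = g y - h y) (at x within S)" if x: "x \<in> S" for x
  proof -
    obtain U where U: "open U" "x \<in> U" "\<And>y. y \<in> S \<Longrightarrow> y \<in> U \<Longrightarrow> dist (g x) (g y) < 1 / 3"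
      using jumps_leE[OF lifts_jumps_le[OF g] x r] by metis
    obtain V where V: "open V" "x \<in> V" "\<And>y. y \<in> S \<Longrightarrow> y \<in> V \<Longrightarrow> dist (h x) (h y) < 1 / 3"
      using jumps_leE[OF lifts_jumps_le[OF h] x r] by metis
    have "g x - h x = g y - h y" if y: "y \<in> U \<inter> V" "y \<in> S" for y
    proof -
      obtain m where m: "g x = h x + of_int m"
        using lifts_diff_int[OF g h x] .
      obtain n where n: "g y = h y + of_int n"
        using lifts_diff_int[OF g h y(2)] .
      have "\<bar>real_of_int m - of_int n\<bar> < 1"
        using U(3)[of y] V(3)[of y] y m n unfolding dist_real_def Int_iff by linarith
      then have "m = n"
        by linarith
      with m n show ?thesis
        by simp
    qed
    then show ?thesis
      unfolding eventually_at_topological using U V by (intro exI[of _ "U \<inter> V"]) auto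
  qed
  show thesis
  proof (cases "S = {}")
    case False
    then obtain a where a: "a \<in> S"
      by blast
    obtain k where k: "g a = h a + of_int k"
      using lifts_diff_int[OF g h a] .
    have "g x = h x + of_int k" if "x \<in> S" for x
      using connected_local_const[OF S that a, of "\<lambda>x. g x - h x"] ev k by auto
    with that show thesis
      by blast
  qed (use that in blast)
qed

text \<open>
  One of the two lifts is shifted by the integer by which they differ on the connected overlap.
\<close>

lemma lifts_glue:
  assumes r: "r < 1 / 3" and A: "closed A" "lifts r A f g" and B: "closed B" "lifts r B f h"
    and AB: "connected (A \<inter> B)"
  obtains k where "lifts r (A \<union> B) f k"
proof -
  obtain n :: int where n: "\<And>x. x \<in> A \<inter> B \<Longrightarrow> g x = h x + of_int n"
    using lifts_unique[OF r AB] lifts_subset A(2) B(2) by (metis inf_le1 inf_le2)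
  define k where "k x = (if x \<in> A then g x else h x + of_int n)" for x
  have kB: "k x = h x + of_int n" if "x \<in> B" for x
    using n that by (auto simp: k_def)
  have "jumps_le dist r A k"
    by (rule jumps_le_cong[of _ _ _ g]) (use A(2) in \<open>auto simp: lifts_def k_def\<close>)
  moreover have "jumps_le dist r B (\<lambda>x. h x + of_int n)"
    using lifts_jumps_le[OF B(2)] by (simp add: jumps_le_def)
  then have "jumps_le dist r B k"
    by (rule jumps_le_cong) (simp add: kB)
  moreover have "circle_pt (k x) = f x" if "x \<in> A \<union> B" for x
    using that A(2) B(2) unfolding lifts_def k_def by auto
  ultimately show thesis
    using jumps_le_Un_closed[OF A(1) _ B(1)] that[of k] unfolding lifts_def by blast
qed

text \<open>
  Near \<open>x\<close>, the value of \<open>g\<close> at \<open>y\<close> is the lift of \<open>f y\<close> closest to a fixed lift of \<open>f x\<close>. This is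
  where \<open>1 / 3\<close> enters: if \<open>z\<close> is near \<open>y\<close>, then the three points \<open>f x\<close>, \<open>f y\<close>, \<open>f z\<close> are at pairwise
  distance less than \<open>1 / 3\<close>, so going around them through the short arcs has total length less
  than \<open>1\<close> and does not wind around the circle. Hence \<open>g y\<close> and \<open>g z\<close> are joined by the short arc
  as well.
\<close>

lemma lifts_local:
  assumes r: "r < 1 / 3" and f: "jumps_le circle_dist r S f" "f ` S \<subseteq> circle" and x: "x \<in> S"
  obtains U g where "open U" "x \<in> U" "lifts r (S \<inter> U) f g"
proof -
  obtain e where e: "r < e" "e < 1 / 3"
    using dense[OF r] by blast
  obtain U where U: "open U" "x \<in> U" "\<And>y. y \<in> S \<Longrightarrow> y \<in> U \<Longrightarrow> circle_dist (f x) (f y) < e"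
    using jumps_leE[OF f(1) x e(1)] by metis
  obtain a where a: "f x = circle_pt a"
    using f(2) x unfolding circle_eq_range by blast
  have "\<forall>y\<in>S \<inter> U. \<exists>t. circle_pt t = f y \<and> dist a t < e"
    using U(3) circle_dist_less_imp_lift[of a "f _" e] f(2) unfolding a
    by (metis Int_iff image_subset_iff)
  from bchoice[OF this] obtain g
    where "\<forall>y\<in>S \<inter> U. circle_pt (g y) = f y \<and> dist a (g y) < e"
    by (elim exE)
  then have g: "circle_pt (g y) = f y" "dist a (g y) < e" if "y \<in> S \<inter> U" for y
    using that by auto
  have "jumps_le dist r (S \<inter> U) g"
    unfolding jumps_le_def
  proof (intro ballI allI impI)
    fix y e' assume y: "y \<in> S \<inter> U" and e': "r < e'"
    have ee': "y \<in> S" "r < min e e'"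
      using y e e' by auto
    obtain V where V: "open V" "y \<in> V"
      "\<And>z. z \<in> S \<Longrightarrow> z \<in> V \<Longrightarrow> circle_dist (f y) (f z) < min e e'"
      using jumps_leE[OF f(1) ee'] by metis
    have "dist (g y) (g z) < e'" if z: "z \<in> S \<inter> U \<inter> V" for z
    proof -
      have "circle_dist (circle_pt (g y)) (circle_pt (g z)) < min e e'"
        using V(3)[of z] g[OF y] g[of z] z by auto
      moreover have "dist (g y) (g z) + min e e' \<le> 1"
        using g[OF y] g[of z] z e(2) dist_triangle3[of "g y" "g z" a] by auto
      ultimately have "dist (g y) (g z) < min e e'"
        by (rule circle_dist_less_imp_dist_less)
      then show ?thesis
        by simp
    qed
    with V show "\<exists>V. open V \<and> y \<in> V \<and> (\<forall>z\<in>S \<inter> U \<inter> V. dist (g y) (g z) < e')"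
      by (intro exI[of _ V]) simp
  qed
  with U(1,2) g that[of U g] show thesis
    unfolding lifts_def by simp
qed

text \<open>
  Lifts on closed rectangles with a common edge can be glued, since that edge is connected.
  Bolzano's bisection principle in the first coordinate turns local lifts into lifts on thin
  strips \<open>[0, 1] \<times> [c, d]\<close>, and bisection in the second coordinate then stacks the strips.
\<close>

lemma lifts_square:
  fixes f :: "real \<times> real \<Rightarrow> real set"
  assumes r: "r < 1 / 3" and f: "jumps_le circle_dist r ({0..1} \<times> {0..1}) f"
    "f ` ({0..1} \<times> {0..1}) \<subseteq> circle"
  obtains g where "lifts r ({0..1} \<times> {0..1}) f g"
proof -
  let ?I = "{0..1::real}"
  define L where "L A \<longleftrightarrow> (\<exists>g. lifts r (?I \<times> ?I \<inter> A) f g)" for A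
  have L_sub: "L A \<Longrightarrow> B \<subseteq> A \<Longrightarrow> L B" for A B
    unfolding L_def by (meson Int_mono lifts_subset order_refl)
  have L_glue: "L (C \<union> D)"
    if "L C" "L D" "closed C" "closed D" "connected (?I \<times> ?I \<inter> (C \<inter> D))" for C D
  proof -
    have eq: "(?I \<times> ?I \<inter> C) \<inter> (?I \<times> ?I \<inter> D) = ?I \<times> ?I \<inter> (C \<inter> D)"
      "(?I \<times> ?I \<inter> C) \<union> (?I \<times> ?I \<inter> D) = ?I \<times> ?I \<inter> (C \<union> D)"
      by auto
    have "closed (?I \<times> ?I \<inter> C)" "closed (?I \<times> ?I \<inter> D)"
      using that by (auto intro!: closed_Int closed_Times)
    then show ?thesis
      using that lifts_glue[OF r, of "?I \<times> ?I \<inter> C" f _ "?I \<times> ?I \<inter> D"]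
      unfolding L_def eq by metis
  qed
  have conn: "connected (?I \<times> ?I \<inter> ({a..b} \<times> {c..d}))" for a b c d
    by (metis Times_Int_Times Int_atLeastAtMost connected_Icc connected_Times)
  \<comment> \<open>The height \<open>\<delta>\<close> of the strip around \<open>y\<close> is part of the property that is bisected, as it shrinks
      with each gluing.\<close>
  have col: "\<exists>\<delta>>0. \<forall>c d. c \<le> y \<and> y \<le> d \<and> d - c < \<delta> \<longrightarrow> L ({0..1} \<times> {c..d})"
    if y: "y \<in> ?I" for y
  proof -
    define Q where "Q a b \<longleftrightarrow>
        (\<exists>\<delta>>0. \<forall>c d. c \<le> y \<and> y \<le> d \<and> d - c < \<delta> \<longrightarrow> L ({a..b} \<times> {c..d}))" for a b
    have "Q 0 1"
    proof (rule Bolzano)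
      fix a b c :: real assume trans: "Q a b" "Q b c" "a \<le> b" "b \<le> c"
      from trans(1,2) obtain \<delta> \<epsilon> where \<delta>: "0 < \<delta>" "\<And>c d. c \<le> y \<and> y \<le> d \<and> d - c < \<delta> \<Longrightarrow> L ({a..b} \<times> {c..d})"
        and \<epsilon>: "0 < \<epsilon>" "\<And>c' d. c' \<le> y \<and> y \<le> d \<and> d - c' < \<epsilon> \<Longrightarrow> L ({b..c} \<times> {c'..d})"
        unfolding Q_def by blast
      have "L ({a..c} \<times> {c'..d})" if "c' \<le> y" "y \<le> d" "d - c' < min \<delta> \<epsilon>" for c' d
      proof -
        have "{a..c} \<times> {c'..d} = {a..b} \<times> {c'..d} \<union> {b..c} \<times> {c'..d}"
          using trans(3,4) by auto
        moreover have "?I \<times> ?I \<inter> ({a..b} \<times> {c'..d} \<inter> {b..c} \<times> {c'..d})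
            = ?I \<times> ?I \<inter> ({b..b} \<times> {c'..d})"
          using trans(3,4) by auto
        ultimately show ?thesis
          using \<delta>(2)[of c' d] \<epsilon>(2)[of c' d] that conn[of b b c' d] L_glue
          by (simp add: closed_Times)
      qed
      then show "Q a c"
        unfolding Q_def using \<delta>(1) \<epsilon>(1) by (intro exI[of _ "min \<delta> \<epsilon>"]) auto
    next
      fix x :: real assume "0 \<le> x" "x \<le> 1"
      then have "(x, y) \<in> ?I \<times> ?I"
        using y by auto
      then obtain U g where U: "open U" "(x, y) \<in> U" "lifts r (?I \<times> ?I \<inter> U) f g"
        using lifts_local[OF r f] by metis
      then obtain A B where AB: "open A" "open B" "x \<in> A" "y \<in> B" "A \<times> B \<subseteq> U"
        by (metis SigmaD1 SigmaD2 open_prod_elim)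
      obtain \<delta> where \<delta>: "0 < \<delta>" "ball x \<delta> \<subseteq> A"
        using AB openE by metis
      obtain \<epsilon> where \<epsilon>: "0 < \<epsilon>" "ball y \<epsilon> \<subseteq> B"
        using AB openE by metis
      have "L ({a..b} \<times> {c..d})" if "a \<le> x" "x \<le> b" "b - a < \<delta>" "c \<le> y" "y \<le> d" "d - c < \<epsilon>"
        for a b c d
      proof -
        have "{a..b} \<subseteq> ball x \<delta>" "{c..d} \<subseteq> ball y \<epsilon>"
          using that by (auto simp: dist_real_def)
        then have "{a..b} \<times> {c..d} \<subseteq> U"
          using \<delta> \<epsilon> AB(5) by blast
        moreover have "L U"
          using U(3) L_def by blast
        ultimately show ?thesis
          using L_sub by blast
      qed
      then show "\<exists>\<delta>>0. \<forall>a b. a \<le> x \<and> x \<le> b \<and> b - a < \<delta> \<longrightarrow> Q a b"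
        unfolding Q_def using \<delta>(1) \<epsilon>(1) by metis
    qed simp
    then show ?thesis
      by (simp add: Q_def)
  qed
  have "L ({0..1} \<times> {0..1})"
  proof (rule Bolzano[where P = "\<lambda>a b. L ({0..1} \<times> {a..b})"])
    fix a b c :: real
    assume trans: "L ({0..1} \<times> {a..b})" "L ({0..1} \<times> {b..c})" "a \<le> b" "b \<le> c"
    have "{0..1::real} \<times> {a..c} = {0..1} \<times> {a..b} \<union> {0..1} \<times> {b..c}"
      using trans(3,4) by auto
    moreover have "?I \<times> ?I \<inter> ({0..1} \<times> {a..b} \<inter> {0..1} \<times> {b..c})
        = ?I \<times> ?I \<inter> ({0..1} \<times> {b..b})"
      using trans(3,4) by auto
    ultimately show "L ({0..1} \<times> {a..c})"
      using trans conn[of 0 1 b b] L_glue by (simp add: closed_Times)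
  next
    fix y :: real assume "0 \<le> y" "y \<le> 1"
    then show "\<exists>\<delta>>0. \<forall>a b. a \<le> y \<and> y \<le> b \<and> b - a < \<delta> \<longrightarrow> L ({0..1} \<times> {a..b})"
      using col[of y] by auto
  qed simp
  then show thesis
    using that unfolding L_def by auto
qed

section \<open>Lifting singular simplices\<close>

text \<open>
  Extend \<open>f\<close> to the square through the retraction, lift there, and restrict.
\<close>

lemma lift_of_retract_of_square:
  fixes \<iota> :: "'a::topological_space \<Rightarrow> real \<times> real"
  assumes r: "r < 1 / 3" and f: "jumps_le circle_dist r S f" "f ` S \<subseteq> circle"
    and \<iota>: "continuous_on S \<iota>" "\<iota> ` S \<subseteq> {0..1} \<times> {0..1}"
    and \<rho>: "continuous_on ({0..1} \<times> {0..1}) \<rho>" "\<rho> ` ({0..1} \<times> {0..1}) \<subseteq> S"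
    and retract: "\<And>x. x \<in> S \<Longrightarrow> \<rho> (\<iota> x) = x"
  obtains g where "lifts r S f g"
proof -
  have "(f \<circ> \<rho>) ` ({0..1} \<times> {0..1}) \<subseteq> circle"
    using f(2) \<rho>(2) by (metis image_comp image_mono subset_trans)
  then obtain g where "lifts r ({0..1} \<times> {0..1}) (f \<circ> \<rho>) g"
    using lifts_square[OF r jumps_le_compose[OF f(1) \<rho>]] by metis
  then have "lifts r S (f \<circ> \<rho> \<circ> \<iota>) (g \<circ> \<iota>)"
    using \<iota> by (rule lifts_compose)
  then have "lifts r S f (g \<circ> \<iota>)"
    unfolding lifts_def using retract by simp
  with that show thesis .
qed

lemma closure_simplex_lift:
  assumes r: "r < 1 / 3" and n: "n = 1 \<or> n = 2"
    and \<sigma>: "closure_simplex n circle (circle_closure r) \<sigma>"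
  obtains g where "lifts r (standard_simplex n) \<sigma> g"
proof -
  have f: "jumps_le circle_dist r (standard_simplex n) \<sigma>" "\<sigma> ` standard_simplex n \<subseteq> circle"
    using \<sigma> by (simp_all add: closure_simplex_circle_iff)
  have \<iota>: "continuous_on (standard_simplex n) (\<lambda>x. (x 1, x 2))"
    "(\<lambda>x. (x 1, x 2)) ` standard_simplex n \<subseteq> {0..1} \<times> {0..1}"
    by (intro continuous_on_Pair continuous_on_subset[OF continuous_on_product_coordinates subset_UNIV])
      (auto simp: standard_simplex_def)
  \<comment> \<open>In the coordinates \<open>(a, b)\<close> of a point of the square, cut \<open>b\<close> down to \<open>1 - a\<close> to get into the
      triangle, and to \<open>0\<close> to get into the segment.\<close>
  define \<rho> :: "real \<times> real \<Rightarrow> nat \<Rightarrow> real" where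
    "\<rho> = (\<lambda>(a, b) i. if i = 1 then a else if i = 2 then (if n = 1 then 0 else min b (1 - a))
           else if i = 0 then 1 - a - (if n = 1 then 0 else min b (1 - a)) else 0)"
  have "continuous_on ({0..1} \<times> {0..1}) (\<lambda>p. \<rho> p i)" for i
    unfolding \<rho>_def case_prod_unfold
    by (cases "i = 0"; cases "i = 1"; cases "i = 2"; cases "n = 1")
      (simp_all, (intro continuous_intros)+)
  then have \<rho>: "continuous_on ({0..1} \<times> {0..1}) \<rho>"
    by (rule continuous_on_coordinatewise_then_product)
  have "\<rho> (a, b) \<in> standard_simplex n" if "a \<in> {0..1}" "b \<in> {0..1}" for a b
    using n that unfolding standard_simplex_def \<rho>_def
    by (auto simp: numeral_2_eq_2 atMost_Suc min_def)
  then have im: "\<rho> ` ({0..1} \<times> {0..1}) \<subseteq> standard_simplex n"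
    by auto
  have "\<rho> (x 1, x 2) = x" if "x \<in> standard_simplex n" for x
  proof -
    have x: "0 \<le> x 0" "\<And>i. i > n \<Longrightarrow> x i = 0" "(\<Sum>i\<le>n. x i) = 1"
      using that by (auto simp: standard_simplex_def)
    from n show ?thesis
    proof
      assume "n = 1"
      with x show ?thesis
        by (auto simp: fun_eq_iff \<rho>_def)
    next
      assume n: "n = 2"
      then have sum: "x 0 + x 1 + x 2 = 1"
        using x(3) by (simp add: numeral_2_eq_2)
      then have "min (x 2) (1 - x 1) = x 2"
        using x(1) by simp
      with x(2) sum n show ?thesis
        by (auto simp: fun_eq_iff \<rho>_def)
    qed
  qed
  with lift_of_retract_of_square[OF r f \<iota> \<rho> im] that show thesis
    by blast
qed

section \<open>Cones\<close>

text \<open>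
  The join of \<open>g\<close> with the value \<open>0\<close> at the vertex \<open>0\<close> of the next simplex, linear on the segments
  from that vertex. At the vertex itself the division by zero is harmless, as the factor in front
  vanishes.
\<close>

definition cone_fun :: "((nat \<Rightarrow> real) \<Rightarrow> real) \<Rightarrow> (nat \<Rightarrow> real) \<Rightarrow> real" where
  "cone_fun g t = (1 - t 0) * g (\<lambda>i. t (Suc i) / (1 - t 0))"

lemma standard_simplex_project_from_vertex:
  assumes "t \<in> standard_simplex (Suc n)" "t 0 < 1"
  shows "(\<lambda>i. t (Suc i) / (1 - t 0)) \<in> standard_simplex n"
proof -
  have t: "\<And>i. 0 \<le> t i" "\<And>i. i > Suc n \<Longrightarrow> t i = 0" "(\<Sum>i\<le>Suc n. t i) = 1"
    using assms(1) by (auto simp: standard_simplex_def)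
  then have s: "(\<Sum>i\<le>n. t (Suc i)) = 1 - t 0"
    using sum.atMost_Suc_shift[of t n] by linarith
  have "t (Suc i) \<le> 1 - t 0" for i
  proof (cases "i \<le> n")
    case True
    then show ?thesis
      unfolding s[symmetric] using t(1) by (intro member_le_sum) auto
  next
    case False
    with t(2)[of "Suc i"] assms(2) show ?thesis
      by simp
  qed
  then show ?thesis
    using t assms(2) s by (auto simp: standard_simplex_def simp flip: sum_divide_distrib)
qed

text \<open>
  Away from the cone point, \<open>cone_fun g\<close> is \<open>g\<close> after a continuous map, multiplied by a continuous
  factor of absolute value at most \<open>1\<close>, so jumps do not grow. At the cone point it tends to \<open>0\<close>
  because \<open>g\<close> is bounded on the compact simplex.
\<close>

lemma jumps_le_cone:
  assumes r: "0 \<le> r" and g: "jumps_le dist r (standard_simplex n) g"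
  shows "jumps_le dist r (standard_simplex (Suc n)) (cone_fun g)"
  unfolding jumps_le_def
proof (intro ballI allI impI)
  let ?S = "standard_simplex (Suc n)"
  let ?h = "\<lambda>t i. t (Suc i) / (1 - t 0) :: real"
  fix t e assume t: "t \<in> ?S" and e: "r < e"
  have "compact (standard_simplex n)"
    using compactin_standard_simplex[of n] by (simp add: euclidean_product_topology)
  then obtain M where M: "0 \<le> M" "\<And>x. x \<in> standard_simplex n \<Longrightarrow> \<bar>g x\<bar> \<le> M"
    using jumps_le_bounded[OF r _ g] by metis
  have le1: "s 0 \<le> 1" "0 \<le> s 0" if "s \<in> ?S" for s
    using that by (auto simp: standard_simplex_def)
  have coord: "continuous_on UNIV (\<lambda>s::nat \<Rightarrow> real. s i)" for i
    by (rule continuous_on_product_coordinates)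
  show "\<exists>U. open U \<and> t \<in> U \<and> (\<forall>s\<in>?S \<inter> U. dist (cone_fun g t) (cone_fun g s) < e)"
  proof (cases "t 0 = 1")
    case True
    let ?U = "{s::nat \<Rightarrow> real. (1 - s 0) * M < e}"
    have "open ?U"
      by (intro open_Collect_less continuous_intros coord)
    moreover have "dist (cone_fun g t) (cone_fun g s) < e" if s: "s \<in> ?S \<inter> ?U" for s
    proof -
      have "\<bar>cone_fun g s\<bar> \<le> (1 - s 0) * M"
      proof (cases "s 0 = 1")
        case False
        then show ?thesis
          using s le1[of s] M(2)[OF standard_simplex_project_from_vertex, of s]
          by (auto simp: cone_fun_def abs_mult intro!: mult_left_mono)
      qed (simp add: cone_fun_def)
      with s True show ?thesis
        by (simp add: cone_fun_def)
    qed
    ultimately show ?thesis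
      using True e r by (intro exI[of _ ?U]) auto
  next
    case False
    let ?S' = "{s\<in>?S. s 0 < 1}"
    have t': "t \<in> ?S'"
      using False t le1[of t] by auto
    obtain e' where e': "r < e'" "e' < e"
      using dense[OF e] by blast
    have "continuous_on ?S' (\<lambda>s. ?h s i)" for i
      by (intro continuous_intros continuous_on_subset[OF coord]) auto
    then have "continuous_on ?S' ?h"
      by (rule continuous_on_coordinatewise_then_product)
    moreover have h: "?h ` ?S' \<subseteq> standard_simplex n"
      using standard_simplex_project_from_vertex by auto
    ultimately have gh: "jumps_le dist r ?S' (g \<circ> ?h)"
      by (rule jumps_le_compose[OF g])
    from gh[unfolded jumps_le_def, THEN bspec, OF t', THEN spec, THEN mp, OF e'(1)]
    obtain U where U: "open U" "t \<in> U"
      "\<forall>s\<in>?S' \<inter> U. dist ((g \<circ> ?h) t) ((g \<circ> ?h) s) < e'"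
      by (elim exE conjE)
    \<comment> \<open>The slack \<open>e - e'\<close> pays for the variation of the factor \<open>1 - s 0\<close>.\<close>
    let ?V = "{s::nat \<Rightarrow> real. s 0 < 1} \<inter> {s. \<bar>s 0 - t 0\<bar> * M < e - e'}"
    have "open ?V"
      by (intro open_Int open_Collect_less continuous_intros coord)
    moreover have "dist (cone_fun g t) (cone_fun g s) < e" if s: "s \<in> ?S \<inter> (U \<inter> ?V)" for s
    proof -
      let ?a = "g (?h t)" and ?b = "g (?h s)"
      have "\<bar>?a - ?b\<bar> < e'"
        using bspec[OF U(3), of s] s by (simp add: dist_real_def)
      moreover have "(1 - t 0) * \<bar>?a - ?b\<bar> \<le> 1 * \<bar>?a - ?b\<bar>"
        using le1[OF t] by (intro mult_right_mono) auto
      moreover have "\<bar>s 0 - t 0\<bar> * \<bar>?b\<bar> \<le> \<bar>s 0 - t 0\<bar> * M"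
        using M(2)[OF standard_simplex_project_from_vertex, of s] s by (intro mult_left_mono) auto
      moreover have "cone_fun g t - cone_fun g s = (1 - t 0) * (?a - ?b) + (s 0 - t 0) * ?b"
        by (simp add: cone_fun_def algebra_simps)
      then have "\<bar>cone_fun g t - cone_fun g s\<bar> \<le> (1 - t 0) * \<bar>?a - ?b\<bar> + \<bar>s 0 - t 0\<bar> * \<bar>?b\<bar>"
        using abs_triangle_ineq[of "(1 - t 0) * (?a - ?b)" "(s 0 - t 0) * ?b"] le1[OF t]
        by (simp add: abs_mult)
      ultimately show ?thesis
        using s unfolding dist_real_def by simp
    qed
    moreover have "t \<in> ?V"
      using t' e' by simp
    ultimately show ?thesis
      using U(1,2) by (intro exI[of _ "U \<inter> ?V"]) auto
  qed
qed

definition project :: "nat \<Rightarrow> ((nat \<Rightarrow> real) \<Rightarrow> real) \<Rightarrow> (nat \<Rightarrow> real) \<Rightarrow> real set" where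
  "project n g = restrict (circle_pt \<circ> g) (standard_simplex n)"

lemma project_eq_lifts:
  assumes "lifts r (standard_simplex n) \<sigma> g" "\<sigma> \<in> extensional (standard_simplex n)"
  shows "project n g = \<sigma>"
  using assms by (intro extensionalityI[of _ "standard_simplex n"])
    (auto simp: project_def lifts_circle_pt)

lemma lifts_project:
  "jumps_le dist r (standard_simplex n) g \<Longrightarrow> lifts r (standard_simplex n) (project n g) g"
  by (simp add: lifts_def project_def)

lemma closure_simplex_project:
  assumes "jumps_le dist r (standard_simplex n) g"
  shows "closure_simplex n circle (circle_closure r) (project n g)"
proof -
  have "jumps_le circle_dist r (standard_simplex n) (project n g)"
    by (rule jumps_le_cong[OF jumps_le_circle_pt[OF assms]]) (simp add: project_def)
  then show ?thesis
    by (auto simp: closure_simplex_circle_iff project_def)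
qed

definition vertex :: "nat \<Rightarrow> nat \<Rightarrow> real" where
  "vertex i = (\<lambda>j. if j = i then 1 else 0)"

lemma vertex_in_standard_simplex [simp]: "vertex i \<in> standard_simplex n \<longleftrightarrow> i \<le> n"
  by (simp add: vertex_def)

text \<open>
  The path in the circle that is covered by the segment from \<open>0\<close> to \<open>b\<close>; the vertex \<open>0\<close> of the
  \<open>1\<close>-simplex goes to \<open>0\<close>. In particular \<open>arc_chain 1\<close> is the standard loop.
\<close>

definition arc_chain :: "real \<Rightarrow> real set chain" where
  "arc_chain b = frag_of (project 1 (\<lambda>x. (1 - x 0) * b))"

lemma singular_face_project:
  assumes "k \<le> Suc n" "\<And>x. x \<in> standard_simplex n \<Longrightarrow> g (simplical_face k x) = h x"
  shows "singular_face (Suc n) k (project (Suc n) g) = project n h"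
  unfolding singular_face_def project_def
  using assms simplical_face_in_standard_simplex[of "Suc n" k]
  by (auto simp: restrict_def fun_eq_iff)

lemma chain_boundary_project_cone:
  "chain_boundary (Suc 1) (frag_of (project (Suc 1) (cone_fun g))) =
     frag_of (project 1 g) - arc_chain (g (vertex 1)) + arc_chain (g (vertex 0))"
proof -
  have cone_vertex: "cone_fun g t = (1 - t 0) * g (vertex k)"
    if "t 0 \<noteq> 1 \<Longrightarrow> (\<lambda>i. t (Suc i) / (1 - t 0)) = vertex k" for t k
    using that by (cases "t 0 = 1") (auto simp: cone_fun_def)
  have x01: "x 1 = 1 - x 0" "\<And>i. i > 1 \<Longrightarrow> x i = 0" if "x \<in> standard_simplex 1" for x
    using that by (auto simp: standard_simplex_def)
  have "singular_face (Suc 1) 0 (project (Suc 1) (cone_fun g)) = project 1 g"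
    by (rule singular_face_project) (auto simp: cone_fun_def simplical_face_def)
  moreover have "singular_face (Suc 1) 1 (project (Suc 1) (cone_fun g))
      = project 1 (\<lambda>x. (1 - x 0) * g (vertex 1))"
  proof (rule singular_face_project)
    fix x :: "nat \<Rightarrow> real" assume "x \<in> standard_simplex 1"
    note x = x01[OF this]
    have "cone_fun g (simplical_face 1 x) = (1 - simplical_face 1 x 0) * g (vertex 1)"
      by (rule cone_vertex) (use x in \<open>auto simp: vertex_def simplical_face_def fun_eq_iff\<close>)
    then show "cone_fun g (simplical_face 1 x) = (1 - x 0) * g (vertex 1)"
      by (simp add: simplical_face_def)
  qed simp
  moreover have "singular_face (Suc 1) 2 (project (Suc 1) (cone_fun g))
      = project 1 (\<lambda>x. (1 - x 0) * g (vertex 0))"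
  proof (rule singular_face_project)
    fix x :: "nat \<Rightarrow> real" assume "x \<in> standard_simplex 1"
    note x = x01[OF this]
    have "cone_fun g (simplical_face 2 x) = (1 - simplical_face 2 x 0) * g (vertex 0)"
      by (rule cone_vertex) (use x in \<open>auto simp: vertex_def simplical_face_def fun_eq_iff\<close>)
    then show "cone_fun g (simplical_face 2 x) = (1 - x 0) * g (vertex 0)"
      by (simp add: simplical_face_def)
  qed simp
  ultimately show ?thesis
    by (simp add: chain_boundary_of arc_chain_def numeral_2_eq_2)
qed

section \<open>Homologous chains\<close>

lemma carrier_closure_chain_group:
  "c \<in> carrier (closure_chain_group n X cl) \<longleftrightarrow> Poly_Mapping.keys c \<subseteq> {\<sigma>. closure_simplex n X cl \<sigma>}"
  by (simp add: closure_chain_group_def free_Abelian_group_def)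

lemma closure_boundaries_frag_of:
  "closure_simplex (Suc n) X cl \<tau> \<Longrightarrow> chain_boundary (Suc n) (frag_of \<tau>) \<in> closure_boundaries n X cl"
  unfolding closure_boundaries_def by (rule imageI) (simp add: carrier_closure_chain_group)

lemma closure_boundaries_0 [simp]: "0 \<in> closure_boundaries n X cl"
  unfolding closure_boundaries_def image_iff
  by (rule bexI[of _ 0]) (simp_all add: carrier_closure_chain_group)

lemma closure_boundaries_diff:
  assumes "a \<in> closure_boundaries n X cl" "b \<in> closure_boundaries n X cl"
  shows "a - b \<in> closure_boundaries n X cl"
proof -
  obtain d e where "a = chain_boundary (Suc n) d" "b = chain_boundary (Suc n) e"
    and de: "d \<in> carrier (closure_chain_group (Suc n) X cl)"
      "e \<in> carrier (closure_chain_group (Suc n) X cl)"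
    using assms unfolding closure_boundaries_def by blast
  then have "a - b = chain_boundary (Suc n) (d - e)"
    by (simp add: chain_boundary_diff)
  moreover have "d - e \<in> carrier (closure_chain_group (Suc n) X cl)"
    using de keys_diff[of d e] by (auto simp: carrier_closure_chain_group)
  ultimately show ?thesis
    unfolding closure_boundaries_def by blast
qed

lemma closure_boundaries_minus:
  "a \<in> closure_boundaries n X cl \<Longrightarrow> - a \<in> closure_boundaries n X cl"
  using closure_boundaries_diff[OF closure_boundaries_0, of a] by simp

lemma closure_boundaries_add:
  "a \<in> closure_boundaries n X cl \<Longrightarrow> b \<in> closure_boundaries n X cl \<Longrightarrow>
     a + b \<in> closure_boundaries n X cl"
  using closure_boundaries_diff[OF _ closure_boundaries_minus, of a n X cl b] by simp

definition homologous :: "real \<Rightarrow> real set chain \<Rightarrow> real set chain \<Rightarrow> bool" where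
  "homologous r a b \<longleftrightarrow> a - b \<in> closure_boundaries 1 circle (circle_closure r)"

lemma homologous_refl [simp]: "homologous r a a"
  by (simp add: homologous_def)

lemma homologous_diff:
  "homologous r a b \<Longrightarrow> homologous r c d \<Longrightarrow> homologous r (a - c) (b - d)"
  unfolding homologous_def using closure_boundaries_diff[of "a - b" 1 circle _ "c - d"]
  by (simp add: algebra_simps)

lemma homologous_add:
  "homologous r a b \<Longrightarrow> homologous r c d \<Longrightarrow> homologous r (a + c) (b + d)"
  unfolding homologous_def using closure_boundaries_add[of "a - b" 1 circle _ "c - d"]
  by (simp add: algebra_simps)

lemma homologous_trans [trans]:
  "homologous r a b \<Longrightarrow> homologous r b c \<Longrightarrow> homologous r a c"
  unfolding homologous_def using closure_boundaries_add[of "a - b" 1 circle _ "b - c"]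
  by simp

lemma homologous_sym: "homologous r a b \<Longrightarrow> homologous r b a"
  unfolding homologous_def using closure_boundaries_minus[of "a - b"] by simp

lemma homologous_frag_extend:
  assumes "\<And>\<sigma>. \<sigma> \<in> S \<Longrightarrow> homologous r (f \<sigma>) (h \<sigma>)" "Poly_Mapping.keys c \<subseteq> S"
  shows "homologous r (frag_extend f c) (frag_extend h c)"
  using assms(2)
  by (induction c rule: frag_induction) (simp_all add: assms(1) frag_extend_diff homologous_diff)

text \<open>
  The cone over a path in the line is a triangle whose other two sides run from \<open>0\<close> to the end
  points of the path. All homologies between \<open>1\<close>-chains that are needed below come from such
  triangles.
\<close>

lemma homologous_project_arcs:
  assumes "closure_simplex (Suc 1) circle (circle_closure r) (project (Suc 1) (cone_fun g))"
  shows "homologous r (frag_of (project 1 g)) (arc_chain (g (vertex 1)) - arc_chain (g (vertex 0)))"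
  using closure_boundaries_frag_of[OF assms]
  unfolding chain_boundary_project_cone homologous_def by (simp add: algebra_simps)

lemma homologous_project_arcs_jumps_le:
  assumes "0 \<le> r" "jumps_le dist r (standard_simplex 1) g"
  shows "homologous r (frag_of (project 1 g)) (arc_chain (g (vertex 1)) - arc_chain (g (vertex 0)))"
  by (intro homologous_project_arcs closure_simplex_project jumps_le_cone assms)

text \<open>
  A choice of one lift for each point of the circle that depends on the point alone.
\<close>

definition angle :: "real set \<Rightarrow> real" where
  "angle P = frac (SOME t. circle_pt t = P)"

lemma angle_circle_pt: "angle (circle_pt t) = frac t"
proof -
  have "circle_pt (SOME s. circle_pt s = circle_pt t) = circle_pt t"
    by (rule someI[of _ t]) simp
  then show ?thesis
    unfolding angle_def by (rule circle_pt_eqE) simp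
qed

lemma circle_pt_angle:
  assumes "P \<in> circle"
  shows "circle_pt (angle P) = P"
proof -
  obtain t where t: "P = circle_pt t"
    using assms unfolding circle_eq_range by auto
  show ?thesis
    unfolding t angle_circle_pt circle_pt_eq_iff frac_def by simp
qed

text \<open>
  A function of the end points of a path, of the form "value at the end minus value at the
  beginning", extends to chains by way of the boundary and so vanishes on cycles.
\<close>

lemma frag_extend_endpoints:
  "frag_extend (\<lambda>\<tau>. F (\<tau> (vertex 0))) (chain_boundary 1 c) =
     frag_extend (\<lambda>\<sigma>. F (\<sigma> (vertex 1)) - F (\<sigma> (vertex 0))) c"
  using subset_UNIV
proof (induction c rule: frag_induction)
  case (one \<sigma>)
  have "simplical_face 0 (vertex 0) = vertex 1" "simplical_face 1 (vertex 0) = vertex 0"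
    by (auto simp: simplical_face_def vertex_def fun_eq_iff)
  then show ?case
    by (simp add: chain_boundary_of frag_extend_diff singular_face_def)
qed (simp_all add: chain_boundary_diff frag_extend_diff)

text \<open>
  The homomorphism to the integers that extends \<open>w\<close>. It is routed through the free Abelian group on
  one generator so that it inherits the linearity of \<^const>\<open>frag_extend\<close>.
\<close>

definition weight :: "('a \<Rightarrow> int) \<Rightarrow> ('a \<Rightarrow>\<^sub>0 int) \<Rightarrow> int" where
  "weight w c = Poly_Mapping.lookup (frag_extend (\<lambda>\<sigma>. frag_cmul (w \<sigma>) (frag_of ())) c) ()"

lemma weight_simps [simp]:
  "weight w 0 = 0" "weight w (frag_of \<sigma>) = w \<sigma>" "weight w (- a) = - weight w a"
  "weight w (a - b) = weight w a - weight w b" "weight w (a + b) = weight w a + weight w b"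
  "weight w (frag_cmul k a) = k * weight w a"
  by (simp_all add: weight_def frag_extend_minus frag_extend_diff frag_extend_add frag_extend_cmul
      lookup_minus lookup_add)

lemma frag_extend_cmul_const: "frag_extend (\<lambda>\<sigma>. frag_cmul (w \<sigma>) z) c = frag_cmul (weight w c) z"
  using subset_UNIV
  by (induction c rule: frag_induction) (simp_all add: frag_extend_diff frag_cmul_diff_distrib)

lemma homologous_cycle:
  assumes c: "c \<in> closure_cycles 1 circle (circle_closure r)"
    and "\<And>\<sigma>. \<sigma> \<in> Poly_Mapping.keys c \<Longrightarrow> homologous r (frag_of \<sigma>)
      (arc_chain (angle (\<sigma> (vertex 1))) - arc_chain (angle (\<sigma> (vertex 0))) + frag_cmul (w \<sigma>) z)"
  shows "homologous r c (frag_cmul (weight w c) z)"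
proof -
  let ?E = "\<lambda>\<sigma>::(nat \<Rightarrow> real) \<Rightarrow> real set.
    arc_chain (angle (\<sigma> (vertex 1))) - arc_chain (angle (\<sigma> (vertex 0)))"
  have "chain_boundary 1 c = 0"
    using c by (simp add: closure_cycles_def kernel_def closure_chain_group_def free_Abelian_group_def)
  then have "frag_extend ?E c = 0"
    using frag_extend_endpoints[of "\<lambda>P. arc_chain (angle P)" c] by simp
  moreover have "frag_extend (\<lambda>\<sigma>. ?E \<sigma> + frag_cmul (w \<sigma>) z) c
      = frag_extend ?E c + frag_extend (\<lambda>\<sigma>. frag_cmul (w \<sigma>) z) c"
    by (simp add: frag_extend_def frag_cmul_distrib2 sum.distrib)
  moreover have "homologous r (frag_extend frag_of c) (frag_extend (\<lambda>\<sigma>. ?E \<sigma> + frag_cmul (w \<sigma>) z) c)"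
    using assms(2) subset_refl by (rule homologous_frag_extend)
  ultimately show ?thesis
    by (simp add: frag_extend_cmul_const flip: frag_expansion)
qed

section \<open>The winding number\<close>

text \<open>
  The arc from \<open>k\<close> to \<open>b + k\<close> in the line lies over the same path as the one from \<open>0\<close> to \<open>b\<close>; compare
  the triangle over it.
\<close>

lemma arc_chain_add_int:
  assumes "0 \<le> r"
  shows "homologous r (arc_chain (b + of_int k)) (arc_chain b + arc_chain (of_int k))"
proof -
  let ?g = "\<lambda>x::nat \<Rightarrow> real. (1 - x 0) * b + of_int k"
  have "jumps_le dist r (standard_simplex 1) ?g"
    by (intro jumps_le_continuous assms continuous_intros continuous_on_product_coordinates)
  then have "homologous r (frag_of (project 1 ?g))
      (arc_chain (?g (vertex 1)) - arc_chain (?g (vertex 0)))"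
    by (rule homologous_project_arcs_jumps_le[OF assms])
  moreover have "project 1 ?g = project 1 (\<lambda>x. (1 - x 0) * b)"
    by (simp add: project_def o_def)
  ultimately have "homologous r (arc_chain b) (arc_chain (b + of_int k) - arc_chain (of_int k))"
    by (simp add: arc_chain_def vertex_def)
  from homologous_add[OF homologous_sym[OF this] homologous_refl[of r "arc_chain (of_int k)"]]
  show ?thesis
    by simp
qed

lemma arc_chain_int:
  assumes r: "0 \<le> r"
  shows "homologous r (arc_chain (of_int k)) (frag_cmul k (arc_chain 1))"
proof (induction k rule: int_induct[of _ 0])
  case base
  have "homologous r (arc_chain 0) (arc_chain 0 + arc_chain 0)"
    using arc_chain_add_int[OF r, of 0 0] by simp
  from homologous_diff[OF homologous_refl[of r "arc_chain 0"] this]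
  have "homologous r 0 (- arc_chain 0)"
    by simp
  from homologous_diff[OF homologous_refl[of r 0] this] show ?case
    by (simp add: homologous_sym)
next
  case (step1 k)
  have "homologous r (arc_chain (of_int (k + 1))) (arc_chain (of_int k) + arc_chain 1)"
    using arc_chain_add_int[OF r, of "of_int k" 1] by simp
  also have "homologous r \<dots> (frag_cmul k (arc_chain 1) + arc_chain 1)"
    using step1 by (simp add: homologous_add)
  finally show ?case
    by (simp add: frag_cmul_distrib)
next
  case (step2 k)
  have "homologous r (arc_chain (of_int k)) (arc_chain (of_int (k - 1)) + arc_chain 1)"
    using arc_chain_add_int[OF r, of "of_int (k - 1)" 1] by simp
  from homologous_diff[OF homologous_sym[OF this] homologous_refl[of r "arc_chain 1"]]
  have "homologous r (arc_chain (of_int (k - 1))) (arc_chain (of_int k) - arc_chain 1)"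
    by simp
  also have "homologous r \<dots> (frag_cmul k (arc_chain 1) - arc_chain 1)"
    using step2 by (simp add: homologous_diff)
  finally show ?case
    by (simp add: frag_cmul_diff_distrib)
qed

lemma arc_chain_frac:
  assumes "0 \<le> r"
  shows "homologous r (arc_chain b) (arc_chain (frac b) + frag_cmul \<lfloor>b\<rfloor> (arc_chain 1))"
proof -
  have "homologous r (arc_chain b) (arc_chain (frac b) + arc_chain (of_int \<lfloor>b\<rfloor>))"
    using arc_chain_add_int[OF assms, of "frac b" "\<lfloor>b\<rfloor>"] by (simp add: frac_def)
  also have "homologous r \<dots> (arc_chain (frac b) + frag_cmul \<lfloor>b\<rfloor> (arc_chain 1))"
    using arc_chain_int[OF assms] by (simp add: homologous_add)
  finally show ?thesis .
qed

text \<open>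
  For a path with lift \<open>g\<close>, the number of times that \<open>g\<close> passes, in the net, the points of the line
  over the base point of the circle. Integer parts make this an integer for every path, closed or
  not.
\<close>

definition winding :: "real \<Rightarrow> ((nat \<Rightarrow> real) \<Rightarrow> real set) \<Rightarrow> int" where
  "winding r \<sigma> =
     (let g = SOME g. lifts r (standard_simplex 1) \<sigma> g in \<lfloor>g (vertex 1)\<rfloor> - \<lfloor>g (vertex 0)\<rfloor>)"

lemma winding_eq:
  assumes r: "r < 1 / 3" and g: "lifts r (standard_simplex 1) \<sigma> g"
  shows "winding r \<sigma> = \<lfloor>g (vertex 1)\<rfloor> - \<lfloor>g (vertex 0)\<rfloor>"
proof -
  define h where "h = (SOME h. lifts r (standard_simplex 1) \<sigma> h)"
  have h: "lifts r (standard_simplex 1) \<sigma> h"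
    unfolding h_def using g by (metis someI)
  have "connected (standard_simplex 1)"
    using connectedin_standard_simplex[of 1] by (simp add: euclidean_product_topology)
  then obtain k :: int where k: "\<And>x. x \<in> standard_simplex 1 \<Longrightarrow> h x = g x + of_int k"
    using lifts_unique[OF r _ h g] by metis
  show ?thesis
    unfolding winding_def h_def[symmetric] Let_def using k by simp
qed

text \<open>
  Up to homology a path only remembers its end points and its winding number: lift it, replace
  it by the difference of two arcs from \<open>0\<close>, and split off the integer parts of their lengths.
\<close>

lemma homologous_winding:
  assumes r: "0 \<le> r" "r < 1 / 3" and \<sigma>: "closure_simplex 1 circle (circle_closure r) \<sigma>"
  shows "homologous r (frag_of \<sigma>)
    (arc_chain (angle (\<sigma> (vertex 1))) - arc_chain (angle (\<sigma> (vertex 0)))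
      + frag_cmul (winding r \<sigma>) (arc_chain 1))"
proof -
  obtain g where g: "lifts r (standard_simplex 1) \<sigma> g"
    using closure_simplex_lift[OF r(2) _ \<sigma>] by blast
  have ext: "\<sigma> \<in> extensional (standard_simplex 1)"
    using \<sigma> by (simp add: closure_simplex_def)
  have angle: "angle (\<sigma> (vertex i)) = frac (g (vertex i))" if "i \<le> 1" for i
    using lifts_circle_pt[OF g, of "vertex i"] that by (metis angle_circle_pt vertex_in_standard_simplex)
  have "homologous r (frag_of \<sigma>) (arc_chain (g (vertex 1)) - arc_chain (g (vertex 0)))"
    using homologous_project_arcs_jumps_le[OF r(1) lifts_jumps_le[OF g]]
    unfolding project_eq_lifts[OF g ext] .
  also have "homologous r \<dots>
      ((arc_chain (frac (g (vertex 1))) + frag_cmul \<lfloor>g (vertex 1)\<rfloor> (arc_chain 1))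
        - (arc_chain (frac (g (vertex 0))) + frag_cmul \<lfloor>g (vertex 0)\<rfloor> (arc_chain 1)))"
    by (intro homologous_diff arc_chain_frac r)
  finally show ?thesis
    by (simp add: angle winding_eq[OF r(2) g] frag_cmul_diff_distrib algebra_simps)
qed

text \<open>
  A lift of a \<open>2\<close>-simplex restricts to lifts of its three sides, and the differences of the
  integer parts at its vertices telescope.
\<close>

lemma weight_winding_boundary:
  assumes r: "r < 1 / 3" and c: "c \<in> closure_boundaries 1 circle (circle_closure r)"
  shows "weight (winding r) c = 0"
proof -
  have face: "weight (winding r) (chain_boundary (Suc 1) (frag_of \<tau>)) = 0"
    if \<tau>: "closure_simplex (Suc 1) circle (circle_closure r) \<tau>" for \<tau>
  proof -
    obtain G where G: "lifts r (standard_simplex (Suc 1)) \<tau> G"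
      using closure_simplex_lift[OF r _ \<tau>] by auto
    have jumps: "jumps_le dist r (standard_simplex 1) (G \<circ> simplical_face k)" if "k \<le> 2" for k
    proof (rule jumps_le_compose[OF lifts_jumps_le[OF G]])
      show "continuous_on (standard_simplex 1) (simplical_face k :: (nat \<Rightarrow> real) \<Rightarrow> _)"
      proof (rule continuous_on_coordinatewise_then_product)
        fix i :: nat
        show "continuous_on (standard_simplex 1) (\<lambda>x::nat \<Rightarrow> real. simplical_face k x i)"
          unfolding simplical_face_def
          by (cases "i < k"; cases "i = k")
            (auto intro!: continuous_on_subset[OF continuous_on_product_coordinates subset_UNIV])
      qed
      show "simplical_face k ` standard_simplex 1 \<subseteq> standard_simplex (Suc 1)"
        using simplical_face_in_standard_simplex[of "Suc 1" k] that by auto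
    qed
    have w: "winding r (singular_face (Suc 1) k \<tau>) =
        \<lfloor>G (simplical_face k (vertex 1))\<rfloor> - \<lfloor>G (simplical_face k (vertex 0))\<rfloor>" if k: "k \<le> 2" for k
    proof -
      have "circle_pt (G (simplical_face k x)) = singular_face (Suc 1) k \<tau> x"
        if "x \<in> standard_simplex 1" for x
        using that k lifts_circle_pt[OF G, of "simplical_face k x"]
          simplical_face_in_standard_simplex[of "Suc 1" k x]
        by (simp add: singular_face_def)
      then have "lifts r (standard_simplex 1) (singular_face (Suc 1) k \<tau>) (G \<circ> simplical_face k)"
        using jumps[OF k] by (simp add: lifts_def)
      from winding_eq[OF r this] show ?thesis
        by simp
    qed
    have "simplical_face 0 (vertex 0) = vertex 1" "simplical_face 0 (vertex 1) = vertex 2"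
      "simplical_face 1 (vertex 0) = vertex 0" "simplical_face 1 (vertex 1) = vertex 2"
      "simplical_face 2 (vertex 0) = vertex 0" "simplical_face 2 (vertex 1) = vertex 1"
      by (auto simp: simplical_face_def vertex_def fun_eq_iff)
    then show ?thesis
      using w[of 0] w[of 1] w[of 2] by (simp add: chain_boundary_of numeral_2_eq_2)
  qed
  obtain d where d: "c = chain_boundary (Suc 1) d"
    "Poly_Mapping.keys d \<subseteq> {\<tau>. closure_simplex (Suc 1) circle (circle_closure r) \<tau>}"
    using c unfolding closure_boundaries_def
    by (elim imageE) (simp add: carrier_closure_chain_group)
  from d(2) have "weight (winding r) (chain_boundary (Suc 1) d) = 0"
    by (induction d rule: frag_induction) (simp_all add: face[simplified] chain_boundary_diff)
  with d(1) show ?thesis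
    by simp
qed

lemma winding_arc_chain_1:
  assumes "0 \<le> r"
  shows "frag_cmul k (arc_chain 1) \<in> closure_cycles 1 circle (circle_closure r)"
    and "r < 1 / 3 \<Longrightarrow> weight (winding r) (frag_cmul k (arc_chain 1)) = k"
proof -
  let ?g = "\<lambda>x::nat \<Rightarrow> real. (1 - x 0) * 1"
  have g: "jumps_le dist r (standard_simplex 1) ?g"
    by (intro jumps_le_continuous assms continuous_intros continuous_on_product_coordinates)
  show "weight (winding r) (frag_cmul k (arc_chain 1)) = k" if "r < 1 / 3"
    using winding_eq[OF that lifts_project[OF g]] by (simp add: arc_chain_def vertex_def)
  have "singular_face (Suc 0) 0 (project (Suc 0) ?g) = project 0 (\<lambda>_. 1)"
    "singular_face (Suc 0) 1 (project (Suc 0) ?g) = project 0 (\<lambda>_. 0)"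
    by (auto intro!: singular_face_project simp: simplical_face_def standard_simplex_0)
  moreover have "project 0 (\<lambda>_. 1) = project 0 (\<lambda>_. 0)"
    using circle_pt_add_int[of 0 1] by (simp add: project_def o_def)
  ultimately have "singular_face 1 0 (project 1 ?g) = singular_face 1 1 (project 1 ?g)"
    by simp
  then have "chain_boundary 1 (arc_chain 1) = 0"
    by (simp add: arc_chain_def chain_boundary_of)
  moreover have "arc_chain 1 \<in> carrier (closure_chain_group 1 circle (circle_closure r))"
    using closure_simplex_project[OF g] by (simp add: carrier_closure_chain_group arc_chain_def)
  ultimately show "frag_cmul k (arc_chain 1) \<in> closure_cycles 1 circle (circle_closure r)"
    using keys_cmul[of k "arc_chain 1"] unfolding closure_cycles_def kernel_def
    by (auto simp: carrier_closure_chain_group chain_boundary_cmul)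
      (simp add: closure_chain_group_def free_Abelian_group_def)
qed

section \<open>The first homology group\<close>

text \<open>
  The winding number is a homomorphism from the cycles onto the integers. Its kernel is the group
  of boundaries, since a cycle \<open>c\<close> is homologous to the loop \<open>arc_chain 1\<close> taken as many times as \<open>c\<close> winds
  around.
\<close>

lemma homology_circle_small:
  assumes r: "0 \<le> r" "r < 1 / 3"
  shows "closure_homology_group 1 circle (circle_closure r) \<cong> integer_group"
proof -
  let ?C = "closure_chain_group 1 circle (circle_closure r)"
  let ?Z = "closure_cycles 1 circle (circle_closure r)"
  let ?B = "closure_boundaries 1 circle (circle_closure r)"
  let ?G = "subgroup_generated ?C ?Z"
  let ?deg = "weight (winding r)"
  have Z: "carrier ?G = ?Z"
    by (rule carrier_closure_cycle_group)
  interpret C: group ?C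
    by (simp add: closure_chain_group_def)
  interpret deg: group_hom ?G integer_group ?deg
    unfolding group_hom_def group_hom_axioms_def using C.group_subgroup_generated[of ?Z]
    by (auto simp: hom_def closure_chain_group_def)
  have "?deg ` carrier ?G = carrier integer_group"
    unfolding Z carrier_integer_group
  proof (intro antisym subset_UNIV subsetI)
    show "k \<in> ?deg ` ?Z" for k
      using winding_arc_chain_1[OF r(1), of k] r(2) by (intro image_eqI[of _ _ "frag_cmul k (arc_chain 1)"]) simp_all
  qed
  then have "?G Mod kernel ?G integer_group ?deg \<cong> integer_group"
    by (rule deg.FactGroup_iso)
  moreover have "kernel ?G integer_group ?deg = ?B"
  proof
    show "?B \<subseteq> kernel ?G integer_group ?deg"
      using weight_winding_boundary[OF r(2)] closure_boundaries_subset_cycles[of 1 circle "circle_closure r"]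
      unfolding kernel_def Z by auto
    show "kernel ?G integer_group ?deg \<subseteq> ?B"
    proof
      fix c assume "c \<in> kernel ?G integer_group ?deg"
      then have c: "c \<in> ?Z" "?deg c = 0"
        unfolding kernel_def Z by auto
      then have "Poly_Mapping.keys c \<subseteq> {\<sigma>. closure_simplex 1 circle (circle_closure r) \<sigma>}"
        by (simp add: closure_cycles_def kernel_def carrier_closure_chain_group)
      then have "homologous r c (frag_cmul (?deg c) (arc_chain 1))"
        by (intro homologous_cycle c homologous_winding r) auto
      with c(2) show "c \<in> ?B"
        by (simp add: homologous_def)
    qed
  qed
  ultimately show ?thesis
    by (simp add: closure_homology_group_def)
qed

text \<open>
  No two points are further apart than \<open>1 / 2\<close>, so every function is a simplex. A path can then be
  lifted pointwise by \<^const>\<open>angle\<close>, without regard to jumps, and the cone over this lift makes it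
  homologous to a difference of arcs that depend on its end points only. These cancel in a cycle.
\<close>

lemma homology_circle_large:
  assumes r: "1 / 2 \<le> r"
  shows "trivial_group (closure_homology_group 1 circle (circle_closure r))"
proof -
  let ?C = "closure_chain_group 1 circle (circle_closure r)"
  let ?Z = "closure_cycles 1 circle (circle_closure r)"
  let ?B = "closure_boundaries 1 circle (circle_closure r)"
  have all: "closure_simplex n circle (circle_closure r) (project n g)" for n g
    unfolding closure_simplex_circle_iff jumps_le_def
  proof (intro conjI ballI allI impI)
    fix x e assume x: "x \<in> standard_simplex n" and e: "r < e"
    have "circle_dist (project n g x) (project n g y) < e" if "y \<in> standard_simplex n" for y
      using circle_dist_le_half[of "circle_pt (g x)" "circle_pt (g y)"] x that r e
      by (simp add: project_def)
    then show "\<exists>U. open U \<and> x \<in> U \<and>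
        (\<forall>y\<in>standard_simplex n \<inter> U. circle_dist (project n g x) (project n g y) < e)"
      by (intro exI[of _ UNIV]) simp
  qed (auto simp: project_def)
  have "?Z \<subseteq> ?B"
  proof
    fix c assume c: "c \<in> ?Z"
    then have keys: "Poly_Mapping.keys c \<subseteq> {\<sigma>. closure_simplex 1 circle (circle_closure r) \<sigma>}"
      by (simp add: closure_cycles_def kernel_def carrier_closure_chain_group)
    have "homologous r (frag_of \<sigma>)
        (arc_chain (angle (\<sigma> (vertex 1))) - arc_chain (angle (\<sigma> (vertex 0))) + frag_cmul 0 0)"
      if "\<sigma> \<in> Poly_Mapping.keys c" for \<sigma>
    proof -
      have \<sigma>: "\<sigma> ` standard_simplex 1 \<subseteq> circle" "\<sigma> \<in> extensional (standard_simplex 1)"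
        using keys that closure_simplex_circle_iff by blast+
      have "circle_pt (angle (\<sigma> x)) = \<sigma> x" if "x \<in> standard_simplex 1" for x
        by (rule circle_pt_angle) (use \<sigma>(1) that in blast)
      then have "project 1 (angle \<circ> \<sigma>) = \<sigma>"
        using \<sigma>(2) unfolding project_def
        by (intro extensionalityI[of _ "standard_simplex 1"]) simp_all
      then show ?thesis
        using homologous_project_arcs[OF all, of "angle \<circ> \<sigma>"] by simp
    qed
    from homologous_cycle[OF c this] show "c \<in> ?B"
      by (simp add: homologous_def)
  qed
  let ?G = "subgroup_generated ?C ?Z"
  from \<open>?Z \<subseteq> ?B\<close> have B: "?B = carrier ?G"
    using closure_boundaries_subset_cycles[of 1 circle "circle_closure r"]
    unfolding carrier_closure_cycle_group by blast
  interpret C: group ?C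
    by (simp add: closure_chain_group_def)
  have "group ?G"
    by (rule C.group_subgroup_generated)
  then have "carrier ?G #>\<^bsub>?G\<^esub> x = carrier ?G" if "x \<in> carrier ?G" for x
    using that by (intro group.coset_join2 group.subgroup_self)
  moreover have "carrier ?G \<noteq> {}"
    using group.is_monoid[OF \<open>group ?G\<close>] monoid.one_closed by blast
  ultimately have "carrier (?G Mod ?B) = {\<one>\<^bsub>?G Mod ?B\<^esub>}"
    unfolding B by (auto simp: FactGroup_def RCOSETS_def)
  moreover have "group (closure_homology_group 1 circle (circle_closure r))"
    using comm_group_closure_homology_group comm_group_def by blast
  ultimately show ?thesis
    unfolding trivial_group_def closure_homology_group_def by simp
qed

theorem corollary5p7:
  fixes r :: real
  assumes "0 \<le> r"
  shows "(r < 1 / 3 \<longrightarrow>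
            closure_homology_group 1 circle (circle_closure r) \<cong> integer_group) \<and>
         (1 / 2 \<le> r \<longrightarrow>
            trivial_group (closure_homology_group 1 circle (circle_closure r)))"
  using homology_circle_small[OF assms] homology_circle_large by blast

end
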